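(* Let $X$ be a rotationally invariant random vector in $\mathbb{R}^n$ with a log-concave density $f_X(x)=f_X(|x|)$, and let $G$ be a standard Gaussian random vector in $\mathbb{R}^n$ (so $\mathbb{E}e^{-\Lambda^\ast_G(G)}=2^{-n/2}$). If $r\mapsto f_X(\sqrt r)$ is log-convex on $(0,\infty)$, then $\mathbb{E}e^{-\Lambda_X^\ast(X)}\geqslant\mathbb{E}e^{-\Lambda_G^\ast(G)}$. If $r\mapsto f_X(\sqrt r)$ is log-concave on $(0,\infty)$, then $\mathbb{E}e^{-\Lambda_X^\ast(X)}\leqslant\mathbb{E}e^{-\Lambda_G^\ast(G)}$.
   Context: Radial functions identified with their profile $r\mapsto f(re_1)$. For a random vector $Z$: $\Lambda_Z(\xi)=\log\mathbb{E}e^{\langle Z,\xi\rangle}$, $\Lambda^\ast_Z(x)=\sup_\xi(\langle x,\xi\rangle-\Lambda_Z(\xi))$. *)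

theory Defs
  imports "HOL-Analysis.Analysis"
begin

text \<open>All quantities are expressed through the law P of the random vector
  (a probability measure on real^'n). Lambda_P may be +infinity, hence ereal.\<close>

definition log_mgf :: "(real ^ 'n::finite) measure \<Rightarrow> real ^ 'n \<Rightarrow> ereal" where
  "log_mgf P \<xi> =
     (let m = (\<integral>\<^sup>+ x. ennreal (exp (x \<bullet> \<xi>)) \<partial>P)
      in if m = \<infinity> then \<infinity> else ereal (ln (enn2real m)))"

definition cramer :: "(real ^ 'n::finite) measure \<Rightarrow> real ^ 'n \<Rightarrow> ereal" where
  "cramer P x = (SUP \<xi>. ereal (x \<bullet> \<xi>) - log_mgf P \<xi>)"

definition exp_neg_ereal :: "ereal \<Rightarrow> ennreal" where
  "exp_neg_ereal y = (case y of ereal r \<Rightarrow> ennreal (exp (- r)) | _ \<Rightarrow> (if y = \<infinity> then 0 else \<infinity>))"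

definition cramer_mean :: "(real ^ 'n::finite) measure \<Rightarrow> ennreal" where
  "cramer_mean P = (\<integral>\<^sup>+ x. exp_neg_ereal (cramer P x) \<partial>P)"

definition std_gaussian_pdf :: "real ^ 'n::finite \<Rightarrow> real" where
  "std_gaussian_pdf x = (2 * pi) powr (- real CARD('n) / 2) * exp (- (norm x)\<^sup>2 / 2)"

definition log_concave_fun :: "('a::real_vector \<Rightarrow> real) \<Rightarrow> 'a set \<Rightarrow> bool" where
  "log_concave_fun h S \<longleftrightarrow> (\<forall>x\<in>S. \<forall>y\<in>S. \<forall>t::real. 0 < t \<and> t < 1 \<longrightarrow>
      h x powr (1 - t) * h y powr t \<le> h ((1 - t) *\<^sub>R x + t *\<^sub>R y))"

definition log_convex_fun :: "('a::real_vector \<Rightarrow> real) \<Rightarrow> 'a set \<Rightarrow> bool" where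
  "log_convex_fun h S \<longleftrightarrow> (\<forall>x\<in>S. \<forall>y\<in>S. \<forall>t::real. 0 < t \<and> t < 1 \<longrightarrow>
      h ((1 - t) *\<^sub>R x + t *\<^sub>R y) \<le> h x powr (1 - t) * h y powr t)"

end

theory Submission
  imports Defs "HOL-Probability.Distributions"
begin

text \<open>Let \<open>\<gamma>\<close> be the centred Gaussian density with the same second moment as \<open>f\<close>. As functions of \<open>|x|\<^sup>2\<close>,
  \<open>\<gamma>\<close> is log-affine, so log-convexity of \<open>f\<close> makes \<open>{f < \<gamma>}\<close> an interval and log-concavity makes
  \<open>{f > \<gamma>}\<close> an interval. Since mass and second moment agree, this gives a comparison of the integrals
  of every convex function of \<open>|x|\<^sup>2\<close>. The even moments are such integrals, and by rotation invariance
  they determine the moment generating function as a power series with nonnegative coefficients; this compares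
  \<open>\<Lambda>\<^sup>*\<close> of \<open>f\<close> with \<open>\<Lambda>\<^sup>*(x) = |x|\<^sup>2 / (2 s\<^sup>2)\<close> of the Gaussian. Finally \<open>exp (- |x|\<^sup>2 / (2 s\<^sup>2))\<close> is itself convex in
  \<open>|x|\<^sup>2\<close>, and its Gaussian expectation does not depend on \<open>s\<close>.\<close>

section \<open>Affine and orthogonal changes of variables for Lebesgue integrals\<close>

lemma nn_integral_lborel_affine:
  fixes u :: "'a::euclidean_space \<Rightarrow> ennreal"
  assumes [measurable]: "u \<in> borel_measurable borel" and "c \<noteq> 0"
  shows "(\<integral>\<^sup>+ x. u x \<partial>lborel) = ennreal (\<bar>c\<bar> ^ DIM('a)) * (\<integral>\<^sup>+ x. u (t + c *\<^sub>R x) \<partial>lborel)"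
  by (subst lborel_affine[OF \<open>c \<noteq> 0\<close>, of t])
     (simp add: nn_integral_density nn_integral_distr nn_integral_cmult)

lemma nn_integral_lborel_shift:
  fixes u :: "'a::euclidean_space \<Rightarrow> ennreal"
  assumes "u \<in> borel_measurable borel"
  shows "(\<integral>\<^sup>+ x. u (t + x) \<partial>lborel) = (\<integral>\<^sup>+ x. u x \<partial>lborel)"
  using nn_integral_lborel_affine[OF assms, of 1 t] by simp

text \<open>Smoothing with the indicator of the unit ball, which an orthogonal map preserves, reduces the
  claim to translation invariance; the determinant-based change of variables is only available for
  well-ordered index types.\<close>
lemma nn_integral_lborel_orthogonal:
  fixes T :: "'a::euclidean_space \<Rightarrow> 'a" and u :: "'a \<Rightarrow> ennreal"
  assumes T: "orthogonal_transformation T" and u [measurable]: "u \<in> borel_measurable borel"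
  shows "(\<integral>\<^sup>+ x. u (T x) \<partial>lborel) = (\<integral>\<^sup>+ x. u x \<partial>lborel)"
proof -
  let ?S = "inv T"
  let ?V = "ennreal (unit_ball_vol (real DIM('a)))"
  have S: "orthogonal_transformation ?S" by (rule orthogonal_transformation_inv[OF T])
  have lin: "linear T" "linear ?S"
    using T S by (auto simp: orthogonal_transformation_linear)
  have TS: "T (?S y) = y" for y
    using orthogonal_transformation_surj[OF T] by (simp add: surj_f_inv_f)
  have [measurable]: "T \<in> borel_measurable borel" "?S \<in> borel_measurable borel"
    using lin by (auto intro!: borel_measurable_continuous_onI linear_continuous_on
        simp: linear_conv_bounded_linear)
  have [measurable]: "ball (0::'a) 1 \<in> sets borel"
    by simp
  have V: "emeasure lborel (ball a 1) = ?V" for a :: 'a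
    by (simp add: emeasure_ball)
  have ball: "indicator (ball 0 1) (y - T x) = (indicator (ball (?S y) 1) x :: ennreal)" for x y
  proof -
    have "norm (y - T x) = norm (T (?S y - x))"
      by (simp add: linear_diff[OF lin(1)] TS)
    also have "\<dots> = norm (?S y - x)"
      by (rule orthogonal_transformation_norm[OF T])
    finally show ?thesis by (simp add: indicator_def dist_norm norm_minus_commute)
  qed
  have "(\<integral>\<^sup>+ x. u (T x) \<partial>lborel) * ?V
      = (\<integral>\<^sup>+ y. (\<integral>\<^sup>+ x. u (T x) * indicator (ball (0::'a) 1) y \<partial>lborel) \<partial>lborel)"
    by (simp add: nn_integral_multc nn_integral_cmult_indicator V)
  \<comment> \<open>For fixed \<open>y\<close>, shifting \<open>x\<close> by \<open>?S y\<close>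
    turns \<open>T x\<close> into \<open>y + T x\<close> and leaves the inner integral
    unchanged.\<close>
  also have "\<dots> = (\<integral>\<^sup>+ y. (\<integral>\<^sup>+ x. u (y + T x) * indicator (ball 0 1) y \<partial>lborel) \<partial>lborel)"
  proof (rule nn_integral_cong)
    fix y :: 'a
    have "(\<integral>\<^sup>+ x. u (T (?S y + x)) \<partial>lborel) = (\<integral>\<^sup>+ x. u (T x) \<partial>lborel)"
      by (rule nn_integral_lborel_shift) measurable
    then show "(\<integral>\<^sup>+ x. u (T x) * indicator (ball 0 1) y \<partial>lborel)
        = (\<integral>\<^sup>+ x. u (y + T x) * indicator (ball 0 1) y \<partial>lborel)"
      by (simp add: nn_integral_multc linear_add[OF lin(1)] TS)
  qed
  also have "\<dots> = (\<integral>\<^sup>+ x. (\<integral>\<^sup>+ y. u (y + T x) * indicator (ball 0 1) y \<partial>lborel) \<partial>lborel)"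
    by (rule lborel_pair.Fubini') measurable
  also have "\<dots> = (\<integral>\<^sup>+ x. (\<integral>\<^sup>+ y. u y * indicator (ball 0 1) (y - T x) \<partial>lborel) \<partial>lborel)"
  proof (rule nn_integral_cong)
    fix x :: 'a
    show "(\<integral>\<^sup>+ y. u (y + T x) * indicator (ball 0 1) y \<partial>lborel)
        = (\<integral>\<^sup>+ y. u y * indicator (ball 0 1) (y - T x) \<partial>lborel)"
      by (subst (2) nn_integral_lborel_shift[symmetric, where t="T x"]) (auto simp: add.commute)
  qed
  also have "\<dots> = (\<integral>\<^sup>+ y. (\<integral>\<^sup>+ x. u y * indicator (ball 0 1) (y - T x) \<partial>lborel) \<partial>lborel)"
    by (rule lborel_pair.Fubini') measurable
  \<comment> \<open>By \<open>ball\<close>, the inner integral over \<open>x\<close> is the volume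
    of a unit ball centred at \<open>?S y\<close>, which is the same for every
    \<open>y\<close>.\<close>
  also have "\<dots> = (\<integral>\<^sup>+ y. u y \<partial>lborel) * ?V"
    by (simp add: ball nn_integral_cmult_indicator V nn_integral_multc)
  finally have eq: "(\<integral>\<^sup>+ x. u (T x) \<partial>lborel) * ?V = (\<integral>\<^sup>+ y. u y \<partial>lborel) * ?V" .
  have "?V \<noteq> 0" "?V \<noteq> \<infinity>"
    using unit_ball_vol_pos[of "real DIM('a)"] by (simp_all add: less_le)
  then show ?thesis
    using eq by (simp add: mult.commute[of _ ?V] ennreal_mult_cancel_left)
qed

section \<open>Even moments and moment generating functions of radial densities\<close>

text \<open>The integral of \<open>(x \<bullet> y) ^ m * f x\<close> over all \<open>x\<close> and
  over \<open>y\<close> in the unit ball is computed in both orders. Rotation invariance replaces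
  \<open>y\<close> by the fixed direction \<open>e\<close> in one order, and \<open>x\<close> by
  \<open>e\<close> in the other. The ball acts as the rotation invariant probe, and the product form
  avoids quotients of moments that may be infinite.\<close>

lemma even_moment_radial:
  fixes e :: "real ^ 'n::finite" and g :: "real \<Rightarrow> real"
  assumes f [measurable]: "f \<in> borel_measurable borel" and nn: "\<And>x. 0 \<le> f x"
    and radial: "\<And>x. f x = g (norm x)" and m: "even m"
  shows "(\<integral>\<^sup>+ x. ennreal ((x \<bullet> e) ^ m * f x) \<partial>lborel) * (\<integral>\<^sup>+ y\<in>ball (0 :: real ^ 'n) 1. ennreal (norm y ^ m) \<partial>lborel)
    = (\<integral>\<^sup>+ x. ennreal (norm x ^ m * f x) \<partial>lborel) * (\<integral>\<^sup>+ y\<in>ball 0 1. ennreal ((y \<bullet> e) ^ m) \<partial>lborel)"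
proof -
  have [measurable]: "ball (0 :: real ^ 'n) 1 \<in> sets borel"
    by simp
  have rot: "(\<integral>\<^sup>+ x. ennreal ((x \<bullet> a) ^ m * h (norm x)) \<partial>lborel)
      = (\<integral>\<^sup>+ x. ennreal ((x \<bullet> b) ^ m * h (norm x)) \<partial>lborel)"
    if "norm a = norm b" and [measurable]: "(\<lambda>x :: real ^ 'n. h (norm x)) \<in> borel_measurable borel"
    for a b :: "real ^ 'n" and h :: "real \<Rightarrow> real"
  proof -
    obtain T where T: "orthogonal_transformation T" "T b = a"
      using orthogonal_transformation_exists[of b a] \<open>norm a = norm b\<close> by metis
    have "(\<integral>\<^sup>+ x. ennreal ((x \<bullet> a) ^ m * h (norm x)) \<partial>lborel)
        = (\<integral>\<^sup>+ x. ennreal ((T x \<bullet> a) ^ m * h (norm (T x))) \<partial>lborel)"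
      by (rule nn_integral_lborel_orthogonal[OF T(1), symmetric])
         measurable
    also have "\<dots> = (\<integral>\<^sup>+ x. ennreal ((x \<bullet> b) ^ m * h (norm x)) \<partial>lborel)"
      using T by (simp add: orthogonal_transformation_norm) (simp add: orthogonal_transformation_def T(2)[symmetric])
    finally show ?thesis .
  qed
  have scale: "ennreal (norm a ^ m) * (\<integral>\<^sup>+ x. ennreal ((x \<bullet> b) ^ m * h (norm x)) \<partial>lborel)
      = ennreal (norm b ^ m) * (\<integral>\<^sup>+ x. ennreal ((x \<bullet> a) ^ m * h (norm x)) \<partial>lborel)"
    if [measurable]: "(\<lambda>x :: real ^ 'n. h (norm x)) \<in> borel_measurable borel"
    for a b :: "real ^ 'n" and h :: "real \<Rightarrow> real"
  proof -
    have pull: "ennreal (c ^ m) * (\<integral>\<^sup>+ x. ennreal ((x \<bullet> b) ^ m * h (norm x)) \<partial>lborel)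
       = (\<integral>\<^sup>+ x. ennreal ((x \<bullet> (c *\<^sub>R b)) ^ m * h (norm x)) \<partial>lborel)" if "c \<ge> 0" for c and b :: "real ^ 'n"
      using that by (subst nn_integral_cmult[symmetric])
        (auto simp: ennreal_mult'[symmetric] power_mult_distrib mult.assoc)
    \<comment> \<open>The vectors \<open>norm a *\<^sub>R b\<close> and
      \<open>norm b *\<^sub>R a\<close> have equal norm, so \<open>rot\<close> applies to them;
      homogeneity of degree \<open>m\<close> then extracts the norms, with zero vectors
      included.\<close>
    show ?thesis
      using pull[of "norm a" b] pull[of "norm b" a]
        rot[of "norm a *\<^sub>R b" "norm b *\<^sub>R a" h, OF _ that] by simp
  qed
  have sph: "ennreal (norm a ^ m) * (\<integral>\<^sup>+ x. ennreal ((x \<bullet> b) ^ m * f x) \<partial>lborel)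
      = ennreal (norm b ^ m) * (\<integral>\<^sup>+ x. ennreal ((x \<bullet> a) ^ m * f x) \<partial>lborel)" for a b
    using scale[of g a b] f unfolding radial[abs_def] by simp
  \<comment> \<open>The unit ball has a radial indicator, so the same scaling rule covers
    it.\<close>
  let ?h = "\<lambda>r. indicator {..<1} r :: real"
  have bi: "ennreal (norm a ^ m) * (\<integral>\<^sup>+ y\<in>ball 0 1. ennreal ((y \<bullet> b) ^ m) \<partial>lborel)
      = ennreal (norm b ^ m) * (\<integral>\<^sup>+ y\<in>ball 0 1. ennreal ((y \<bullet> a) ^ m) \<partial>lborel)" for a b :: "real ^ 'n"
  proof -
    have "ennreal (c ^ m) * indicator (ball (0 :: real ^ 'n) 1) y = ennreal (c ^ m * ?h (norm y))" for c and y :: "real ^ 'n"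
      by (auto simp: indicator_def)
    then show ?thesis
      using scale[of ?h a b] by simp
  qed
  have "(\<integral>\<^sup>+ x. ennreal ((x \<bullet> e) ^ m * f x) \<partial>lborel) * (\<integral>\<^sup>+ y\<in>ball (0 :: real ^ 'n) 1. ennreal (norm y ^ m) \<partial>lborel)
     = (\<integral>\<^sup>+ y. (ennreal (norm y ^ m) * (\<integral>\<^sup>+ x. ennreal ((x \<bullet> e) ^ m * f x) \<partial>lborel)) * indicator (ball (0 :: real ^ 'n) 1) y \<partial>lborel)"
    by (subst nn_integral_cmult[symmetric]) (auto simp: ac_simps)
  also have "\<dots> = (\<integral>\<^sup>+ y. (ennreal (norm e ^ m) * (\<integral>\<^sup>+ x. ennreal ((x \<bullet> y) ^ m * f x) \<partial>lborel)) * indicator (ball (0 :: real ^ 'n) 1) y \<partial>lborel)"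
    by (simp only: sph[of _ e])
  also have "\<dots> = (\<integral>\<^sup>+ y. (\<integral>\<^sup>+ x. ennreal (norm e ^ m) * ennreal ((x \<bullet> y) ^ m * f x) * indicator (ball (0 :: real ^ 'n) 1) y \<partial>lborel) \<partial>lborel)"
    by (simp add: nn_integral_cmult nn_integral_multc)
  also have "\<dots> = (\<integral>\<^sup>+ x. (\<integral>\<^sup>+ y. ennreal (norm e ^ m) * ennreal ((x \<bullet> y) ^ m * f x) * indicator (ball (0 :: real ^ 'n) 1) y \<partial>lborel) \<partial>lborel)"
    by (rule lborel_pair.Fubini') measurable
  also have "\<dots> = (\<integral>\<^sup>+ x. ennreal (f x) * (ennreal (norm e ^ m) * (\<integral>\<^sup>+ y\<in>ball 0 1. ennreal ((y \<bullet> x) ^ m) \<partial>lborel)) \<partial>lborel)"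
    using m by (simp add: nn_integral_cmult[symmetric] ennreal_mult'' nn zero_le_even_power inner_commute ac_simps)
  also have "\<dots> = (\<integral>\<^sup>+ x. ennreal (norm x ^ m * f x) * (\<integral>\<^sup>+ y\<in>ball 0 1. ennreal ((y \<bullet> e) ^ m) \<partial>lborel) \<partial>lborel)"
    by (simp only: bi[of e]) (simp add: ennreal_mult'' nn ac_simps)
  also have "\<dots> = (\<integral>\<^sup>+ x. ennreal (norm x ^ m * f x) \<partial>lborel) * (\<integral>\<^sup>+ y\<in>ball 0 1. ennreal ((y \<bullet> e) ^ m) \<partial>lborel)"
    by (rule nn_integral_multc) measurable
  finally show ?thesis .
qed

text \<open>The factor relating directional to radial moments in \<open>even_moment_radial\<close>
  is the same for both densities, and the ball moment \<open>?B\<close> is positive and finite, so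
  it cancels.\<close>

lemma even_moment_radial_mono:
  fixes e :: "real ^ 'n::finite" and g h :: "real \<Rightarrow> real"
  assumes p: "p \<in> borel_measurable borel" "\<And>x. 0 \<le> p x" "\<And>x. p x = g (norm x)"
    and q: "q \<in> borel_measurable borel" "\<And>x. 0 \<le> q x" "\<And>x. q x = h (norm x)"
    and m: "even m"
    and le: "(\<integral>\<^sup>+ x. ennreal (norm x ^ m * p x) \<partial>lborel) \<le> (\<integral>\<^sup>+ x. ennreal (norm x ^ m * q x) \<partial>lborel)"
  shows "(\<integral>\<^sup>+ x. ennreal ((x \<bullet> e) ^ m * p x) \<partial>lborel) \<le> (\<integral>\<^sup>+ x. ennreal ((x \<bullet> e) ^ m * q x) \<partial>lborel)"
proof -
  let ?B = "\<integral>\<^sup>+ y\<in>ball (0::real^'n) 1. ennreal (norm y ^ m) \<partial>lborel"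
  have [measurable]: "ball (0::real^'n) 1 \<in> sets borel"
    by simp
  have "?B \<le> (\<integral>\<^sup>+ y. indicator (ball (0::real^'n) 1) y \<partial>lborel)"
    by (intro nn_integral_mono) (auto simp: indicator_def power_le_one)
  also have "\<dots> < \<infinity>"
    by (simp add: emeasure_ball)
  finally have fin: "?B \<noteq> top" by simp
  \<comment> \<open>The integrand is positive on the ball except possibly at the origin, so a
    vanishing integral would make the ball a null set.\<close>
  have "?B \<noteq> 0"
  proof
    assume "?B = 0"
    then have "AE y in lborel. ennreal (norm y ^ m) * indicator (ball (0::real^'n) 1) y = 0"
      by (subst (asm) nn_integral_0_iff_AE) auto
    moreover have "AE y in lborel. y \<noteq> (0::real^'n)"
      by (rule AE_lborel_singleton)
    ultimately have "AE y in lborel. y \<notin> ball (0::real^'n) 1"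
      by eventually_elim (auto simp: indicator_def split: if_splits)
    then have "emeasure lborel (ball (0::real^'n) 1) = 0"
      by (subst (asm) AE_iff_measurable[of "ball 0 1"]) auto
    then show False
      using unit_ball_vol_pos[of "real CARD('n)"] by (simp add: emeasure_ball)
  qed
  moreover have "?B * (\<integral>\<^sup>+ x. ennreal ((x \<bullet> e) ^ m * p x) \<partial>lborel) \<le> ?B * (\<integral>\<^sup>+ x. ennreal ((x \<bullet> e) ^ m * q x) \<partial>lborel)"
  proof -
    have "?B * (\<integral>\<^sup>+ x. ennreal ((x \<bullet> e) ^ m * p x) \<partial>lborel)
        = (\<integral>\<^sup>+ x. ennreal (norm x ^ m * p x) \<partial>lborel) * (\<integral>\<^sup>+ y\<in>ball 0 1. ennreal ((y \<bullet> e) ^ m) \<partial>lborel)"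
      by (subst mult.commute, rule even_moment_radial[OF p m])
    also have "\<dots> \<le> (\<integral>\<^sup>+ x. ennreal (norm x ^ m * q x) \<partial>lborel) * (\<integral>\<^sup>+ y\<in>ball 0 1. ennreal ((y \<bullet> e) ^ m) \<partial>lborel)"
      by (rule mult_right_mono[OF le]) simp
    also have "\<dots> = ?B * (\<integral>\<^sup>+ x. ennreal ((x \<bullet> e) ^ m * q x) \<partial>lborel)"
      by (subst (2) mult.commute, rule even_moment_radial[OF q m, symmetric])
    finally show ?thesis .
  qed
  ultimately show ?thesis
    using fin ennreal_mult_le_mult_iff[of ?B] by blast
qed

text \<open>Since \<open>f\<close> is even, \<open>exp\<close> may be replaced by
  \<open>cosh\<close>, whose Taylor series has only even powers and nonnegative terms. Termwise
  integration is then valid in \<open>ennreal\<close>, also when the value is infinite.\<close>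

lemma nn_integral_exp_radial:
  fixes e :: "real ^ 'n::finite" and g :: "real \<Rightarrow> real"
  assumes f [measurable]: "f \<in> borel_measurable borel" and nn: "\<And>x. 0 \<le> f x"
    and radial: "\<And>x. f x = g (norm x)"
  shows "(\<integral>\<^sup>+ x. ennreal (exp (x \<bullet> e) * f x) \<partial>lborel)
    = (\<Sum>m. if even m then ennreal (inverse (fact m)) * (\<integral>\<^sup>+ x. ennreal ((x \<bullet> e) ^ m * f x) \<partial>lborel) else 0)"
proof -
  let ?E = "\<integral>\<^sup>+ x. ennreal (exp (x \<bullet> e) * f x) \<partial>lborel"
  have cosh2: "2 * cosh t = exp t + exp (- t)" for t :: real
    by (simp add: cosh_def)
  have even: "f (- x) = f x" for x
    by (simp add: radial)
  have flip: "(\<integral>\<^sup>+ x. ennreal (exp (- (x \<bullet> e)) * f x) \<partial>lborel) = ?E"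
    using nn_integral_lborel_affine[of "\<lambda>x. ennreal (exp (x \<bullet> e) * f x)" "-1" 0]
    by (simp add: even)
  \<comment> \<open>Adding the reflected integral produces \<open>2 * cosh\<close>; the finite
    nonzero factor 2 is cancelled afterwards.\<close>
  have "2 * ?E = (\<integral>\<^sup>+ x. ennreal (exp (x \<bullet> e) * f x) + ennreal (exp (- (x \<bullet> e)) * f x) \<partial>lborel)"
    by (subst nn_integral_add) (auto simp: flip mult_2)
  also have "\<dots> = (\<integral>\<^sup>+ x. 2 * ennreal (cosh (x \<bullet> e) * f x) \<partial>lborel)"
  proof (rule nn_integral_cong)
    fix x
    have "ennreal (exp (x \<bullet> e) * f x) + ennreal (exp (- (x \<bullet> e)) * f x) = ennreal (2 * (cosh (x \<bullet> e) * f x))"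
      using nn[of x] by (simp flip: ennreal_plus distrib_right mult.assoc add: cosh2)
    also have "\<dots> = 2 * ennreal (cosh (x \<bullet> e) * f x)"
      by (subst ennreal_mult) (auto simp: nn less_imp_le[OF cosh_real_pos])
    finally show "ennreal (exp (x \<bullet> e) * f x) + ennreal (exp (- (x \<bullet> e)) * f x) = 2 * ennreal (cosh (x \<bullet> e) * f x)" .
  qed
  also have "\<dots> = 2 * (\<integral>\<^sup>+ x. ennreal (cosh (x \<bullet> e) * f x) \<partial>lborel)"
    by (rule nn_integral_cmult) (simp add: cosh_def)
  finally have "?E = (\<integral>\<^sup>+ x. ennreal (cosh (x \<bullet> e) * f x) \<partial>lborel)"
    by (subst (asm) ennreal_mult_cancel_left) auto
  also have "\<dots> = (\<integral>\<^sup>+ x. (\<Sum>m. ennreal (if even m then inverse (fact m) * ((x \<bullet> e) ^ m * f x) else 0)) \<partial>lborel)"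
  proof (rule nn_integral_cong)
    fix x
    have "(\<lambda>m. (if even m then (x \<bullet> e) ^ m /\<^sub>R fact m else 0) * f x) sums (cosh (x \<bullet> e) * f x)"
      by (intro sums_mult2 cosh_converges)
    then have "(\<lambda>m. if even m then inverse (fact m) * ((x \<bullet> e) ^ m * f x) else 0) sums (cosh (x \<bullet> e) * f x)"
      by (rule sums_cong[THEN iffD1, rotated]) (simp add: ac_simps)
    then show "ennreal (cosh (x \<bullet> e) * f x) = (\<Sum>m. ennreal (if even m then inverse (fact m) * ((x \<bullet> e) ^ m * f x) else 0))"
      by (intro suminf_ennreal_eq[symmetric]) (auto simp: nn zero_le_even_power)
  qed
  also have "\<dots> = (\<Sum>m. \<integral>\<^sup>+ x. ennreal (if even m then inverse (fact m) * ((x \<bullet> e) ^ m * f x) else 0) \<partial>lborel)"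
    by (rule nn_integral_suminf) auto
  also have "\<dots> = (\<Sum>m. if even m then ennreal (inverse (fact m)) * (\<integral>\<^sup>+ x. ennreal ((x \<bullet> e) ^ m * f x) \<partial>lborel) else 0)"
    by (intro suminf_cong) (simp add: ennreal_mult' nn_integral_cmult)
  finally show ?thesis .
qed

lemma nn_integral_exp_radial_mono:
  fixes e :: "real ^ 'n::finite" and g h :: "real \<Rightarrow> real"
  assumes p: "p \<in> borel_measurable borel" "\<And>x. 0 \<le> p x" "\<And>x. p x = g (norm x)"
    and q: "q \<in> borel_measurable borel" "\<And>x. 0 \<le> q x" "\<And>x. q x = h (norm x)"
    and le: "\<And>m. even m \<Longrightarrow> (\<integral>\<^sup>+ x. ennreal (norm x ^ m * p x) \<partial>lborel) \<le> (\<integral>\<^sup>+ x. ennreal (norm x ^ m * q x) \<partial>lborel)"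
  shows "(\<integral>\<^sup>+ x. ennreal (exp (x \<bullet> e) * p x) \<partial>lborel) \<le> (\<integral>\<^sup>+ x. ennreal (exp (x \<bullet> e) * q x) \<partial>lborel)"
  unfolding nn_integral_exp_radial[OF p] nn_integral_exp_radial[OF q]
  by (intro suminf_le) (auto intro!: mult_left_mono even_moment_radial_mono[OF p q _ le])

section \<open>Convex order of densities with equal mass and second moment\<close>

text \<open>The chord inequality with denominators cleared, so that coinciding points are allowed.
  Placing the chord's end points at different positions among the three gives both the bound inside
  the chord and those outside it.\<close>

lemma convex_on_three_points:
  fixes \<phi> :: "real \<Rightarrow> real"
  assumes "convex_on S \<phi>" "a \<in> S" "c \<in> S" "a \<le> b" "b \<le> c"
  shows "(c - a) * \<phi> b \<le> (c - b) * \<phi> a + (b - a) * \<phi> c"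
proof (cases "a = c")
  case False
  define t where "t = (b - a) / (c - a)"
  have t: "0 \<le> t" "t \<le> 1" and tca: "t * (c - a) = b - a"
    using assms False by (auto simp: t_def)
  have "(1 - t) * a + t * c = a + t * (c - a)"
    by algebra
  then have tb: "(1 - t) *\<^sub>R a + t *\<^sub>R c = b"
    by (simp add: tca)
  have "\<phi> b \<le> (1 - t) * \<phi> a + t * \<phi> c"
    using convex_onD[OF assms(1) t assms(2,3)] tb by simp
  then have "(c - a) * \<phi> b \<le> (c - a) * ((1 - t) * \<phi> a + t * \<phi> c)"
    using assms by (intro mult_left_mono) auto
  also have "\<dots> = ((c - a) - t * (c - a)) * \<phi> a + (t * (c - a)) * \<phi> c"
    by algebra
  also have "\<dots> = (c - b) * \<phi> a + (b - a) * \<phi> c"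
    by (simp add: tca)
  finally show ?thesis .
qed (use assms in auto)

text \<open>Spheres are null sets. This disposes of the origin and of the radii where two densities
  may cross.\<close>

lemma AE_lborel_norm_neq:
  "AE x in lborel. norm (x :: 'a::euclidean_space) \<noteq> r"
proof (rule AE_I')
  show "sphere (0::'a) r \<in> null_sets lborel"
    using negligible_sphere[of "0::'a" r]
    by (auto simp: null_sets_completion_iff negligible_iff_null_sets)
qed auto

text \<open>Finiteness is stated for \<open>q\<close> and passes to \<open>p\<close> through the
  equalities. The intended reading is that \<open>p\<close> is the more spread out density.\<close>

locale same_mass_moment =
  fixes p q :: "'a::euclidean_space \<Rightarrow> real"
  assumes p_meas [measurable]: "p \<in> borel_measurable borel" and p_nonneg: "\<And>x. 0 \<le> p x"
    and q_meas [measurable]: "q \<in> borel_measurable borel" and q_nonneg: "\<And>x. 0 \<le> q x"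
    and mass: "(\<integral>\<^sup>+ x. ennreal (p x) \<partial>lborel) = (\<integral>\<^sup>+ x. ennreal (q x) \<partial>lborel)"
    and mass_fin: "(\<integral>\<^sup>+ x. ennreal (q x) \<partial>lborel) < \<infinity>"
    and moment: "(\<integral>\<^sup>+ x. ennreal ((norm x)\<^sup>2 * p x) \<partial>lborel) = (\<integral>\<^sup>+ x. ennreal ((norm x)\<^sup>2 * q x) \<partial>lborel)"
    and moment_fin: "(\<integral>\<^sup>+ x. ennreal ((norm x)\<^sup>2 * q x) \<partial>lborel) < \<infinity>"
begin

lemma integrable:
  "integrable lborel p" "integrable lborel q"
  "integrable lborel (\<lambda>x. (norm x)\<^sup>2 * p x)" "integrable lborel (\<lambda>x. (norm x)\<^sup>2 * q x)"
  using mass mass_fin moment moment_fin by (auto intro!: integrableI_nonneg simp: p_nonneg q_nonneg)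

lemma integral_eq:
  "integral\<^sup>L lborel p = integral\<^sup>L lborel q"
  "(\<integral> x. (norm x)\<^sup>2 * p x \<partial>lborel) = (\<integral> x. (norm x)\<^sup>2 * q x \<partial>lborel)"
  using mass moment by (simp_all add: integral_eq_nn_integral p_nonneg q_nonneg)

lemma integral_affine:
  "integrable lborel (\<lambda>x. (a * (norm x)\<^sup>2 + b) * (p x - q x))"
  "(\<integral> x. (a * (norm x)\<^sup>2 + b) * (p x - q x) \<partial>lborel) = 0"
proof -
  have eq: "(a * (norm x)\<^sup>2 + b) * (p x - q x)
      = (a * ((norm x)\<^sup>2 * p x) - a * ((norm x)\<^sup>2 * q x)) + (b * p x - b * q x)" for x
    by algebra
  show "integrable lborel (\<lambda>x. (a * (norm x)\<^sup>2 + b) * (p x - q x))"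
    unfolding eq using integrable by auto
  show "(\<integral> x. (a * (norm x)\<^sup>2 + b) * (p x - q x) \<partial>lborel) = 0"
    unfolding eq using integrable by (simp add: integral_eq)
qed

text \<open>The sign condition says that \<open>\<psi> x * q x\<close> is at most
  \<open>\<psi> x * p x\<close> minus an affine function of \<open>|x|^2\<close> times
  \<open>p x - q x\<close>, and this correction integrates to zero. If the integral against
  \<open>p\<close> is infinite the claim is trivial, so integrability is only needed for
  \<open>\<psi> x * p x\<close>.\<close>

lemma nn_integral_le_by_affine:
  assumes [measurable]: "\<psi> \<in> borel_measurable borel" and nn: "\<And>x. 0 \<le> \<psi> x"
    and sgn: "AE x in lborel. 0 \<le> (\<psi> x - (a * (norm x)\<^sup>2 + b)) * (p x - q x)"
  shows "(\<integral>\<^sup>+ x. ennreal (\<psi> x * q x) \<partial>lborel) \<le> (\<integral>\<^sup>+ x. ennreal (\<psi> x * p x) \<partial>lborel)"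
proof (cases "(\<integral>\<^sup>+ x. ennreal (\<psi> x * p x) \<partial>lborel) = \<infinity>")
  case False
  then have int: "integrable lborel (\<lambda>x. \<psi> x * p x)"
    by (intro integrableI_nonneg) (auto simp: nn p_nonneg less_top)
  let ?r = "\<lambda>x. \<psi> x * p x - (a * (norm x)\<^sup>2 + b) * (p x - q x)"
  have le: "AE x in lborel. \<psi> x * q x \<le> ?r x"
    using sgn by eventually_elim (simp add: algebra_simps)
  then have "(\<integral>\<^sup>+ x. ennreal (\<psi> x * q x) \<partial>lborel) \<le> (\<integral>\<^sup>+ x. ennreal (?r x) \<partial>lborel)"
    by (intro nn_integral_mono_AE) (auto elim!: eventually_mono intro: ennreal_leI)
  also have "\<dots> = ennreal (integral\<^sup>L lborel ?r)"
  proof (rule nn_integral_eq_integral)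
    show "integrable lborel ?r"
      using int integral_affine by auto
    show "AE x in lborel. 0 \<le> ?r x"
      using le
    proof eventually_elim
      case (elim x)
      have "0 \<le> \<psi> x * q x" by (simp add: nn q_nonneg)
      then show ?case using elim by linarith
    qed
  qed
  also have "integral\<^sup>L lborel ?r = (\<integral> x. \<psi> x * p x \<partial>lborel)"
    using int integral_affine by simp
  also have "ennreal \<dots> = (\<integral>\<^sup>+ x. ennreal (\<psi> x * p x) \<partial>lborel)"
    by (rule nn_integral_eq_integral[symmetric]) (auto simp: int nn p_nonneg)
  finally show ?thesis .
qed auto

text \<open>The convex function is compared with its chord over the interval where \<open>p < q\<close>; the chord
  integrates equally against both densities.\<close>
lemma convex_order:
  fixes \<phi> :: "real \<Rightarrow> real"
  assumes I: "is_interval I" "I \<subseteq> {0<..}"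
    and less: "\<And>x. (norm x)\<^sup>2 \<in> I \<Longrightarrow> p x \<le> q x"
    and ge: "\<And>x. x \<noteq> 0 \<Longrightarrow> (norm x)\<^sup>2 \<notin> I \<Longrightarrow> q x \<le> p x"
    and convex: "convex_on {0..} \<phi>" and nn: "\<And>u. 0 \<le> u \<Longrightarrow> 0 \<le> \<phi> u"
    and [measurable]: "(\<lambda>x::'a. \<phi> ((norm x)\<^sup>2)) \<in> borel_measurable borel"
  shows "(\<integral>\<^sup>+ x. ennreal (\<phi> ((norm x)\<^sup>2) * q x) \<partial>lborel) \<le> (\<integral>\<^sup>+ x. ennreal (\<phi> ((norm x)\<^sup>2) * p x) \<partial>lborel)"
proof (cases "\<exists>a\<in>I. \<exists>b\<in>I. a < b")
  \<comment> \<open>The interval has at most one point, so \<open>q \<le> p\<close> holds off a null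
    set.\<close>
  case False
  obtain a where a: "I \<subseteq> {a}"
    using False by (cases "I = {}") (auto, metis linorder_neqE_linordered_idom singletonI subsetI)
  have "AE x in lborel. q x \<le> p x"
    using AE_lborel_norm_neq[of 0] AE_lborel_norm_neq[of "sqrt a"]
  proof eventually_elim
    case (elim x)
    then have "(norm x)\<^sup>2 \<noteq> a"
      by (metis norm_ge_zero real_sqrt_unique)
    then show ?case using elim a by (intro ge) auto
  qed
  then show ?thesis
    by (intro nn_integral_mono_AE) (auto elim!: eventually_mono intro!: ennreal_leI mult_left_mono nn)
next
  case nontrivial: True
  have ne: "I \<noteq> {}" and bdd_below: "bdd_below I"
    using nontrivial I(2) by (auto intro!: bdd_belowI[of _ 0])
  define a where "a = Inf I"
  have a0: "0 \<le> a"
    unfolding a_def using I(2) ne by (intro cInf_greatest) auto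
  have below: "u \<notin> I" if "u < a" for u
    using that bdd_below cInf_lower[of u I] by (auto simp: a_def)
  show ?thesis
  proof (cases "bdd_above I")
    case bdd: True
    define b where "b = Sup I"
    have above: "u \<notin> I" if "b < u" for u
      using that bdd cSup_upper[of u I] by (auto simp: b_def)
    have ab: "a < b"
      using nontrivial above below by (meson leI less_le_trans le_less_trans)
    have inside: "u \<in> I" if u: "a < u" "u < b" for u
    proof -
      obtain v w where "v \<in> I" "v < u" "w \<in> I" "u < w"
        using cInf_lessD[OF ne, of u] less_cSupD[OF ne, of u] u unfolding a_def b_def by blast
      then show ?thesis
        using I(1) by (meson is_interval_1 less_imp_le)
    qed
    \<comment> \<open>\<open>\<alpha>\<close> is the slope of the chord of \<open>\<phi>\<close>
      over the interval from \<open>a\<close> to \<open>b\<close>, and \<open>l\<close> is the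
      affine function of that chord.\<close>
    define \<alpha> where "\<alpha> = (\<phi> b - \<phi> a) / (b - a)"
    define l where "l u = \<alpha> * u + (\<phi> a - \<alpha> * a)" for u
    have l: "(b - a) * l u = (b - u) * \<phi> a + (u - a) * \<phi> b" for u
    proof -
      have "(b - a) * \<alpha> = \<phi> b - \<phi> a"
        using ab by (simp add: \<alpha>_def)
      then show ?thesis
        unfolding l_def by algebra
    qed
    have pos: "0 < b - a" using ab by simp
    have chord_in: "\<phi> u \<le> l u" if "a \<le> u" "u \<le> b" for u
    proof -
      have "(b - a) * \<phi> u \<le> (b - a) * l u"
        unfolding l using convex_on_three_points[OF convex, of a b u] that a0 ab by simp
      then show ?thesis using pos by simp
    qed
    have chord_lo: "l u \<le> \<phi> u" if "0 \<le> u" "u \<le> a" for u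
    proof -
      have "(b - u) * \<phi> a \<le> (b - a) * \<phi> u + (a - u) * \<phi> b"
        using convex_on_three_points[OF convex, of u b a] that a0 ab by simp
      then have "(b - a) * l u \<le> (b - a) * \<phi> u"
        unfolding l by (simp add: algebra_simps)
      then show ?thesis using pos by simp
    qed
    have chord_hi: "l u \<le> \<phi> u" if "b \<le> u" for u
    proof -
      have "(u - a) * \<phi> b \<le> (u - b) * \<phi> a + (b - a) * \<phi> u"
        using convex_on_three_points[OF convex, of a u b] that a0 ab by simp
      then have "(b - a) * l u \<le> (b - a) * \<phi> u"
        unfolding l by (simp add: algebra_simps)
      then show ?thesis using pos by simp
    qed
    have "AE x in lborel. 0 \<le> (\<phi> ((norm x)\<^sup>2) - (\<alpha> * (norm x)\<^sup>2 + (\<phi> a - \<alpha> * a))) * (p x - q x)"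
      using AE_lborel_norm_neq[of 0]
    proof eventually_elim
      case (elim x)
      define u where "u = (norm x)\<^sup>2"
      have u0: "0 \<le> u" by (simp add: u_def)
      have x0: "x \<noteq> 0" using elim by auto
      consider "u < a" | "u = a \<or> u = b" | "a < u" "u < b" | "b < u"
        by linarith
      then have "0 \<le> (\<phi> u - l u) * (p x - q x)"
      proof cases
        case 1
        then show ?thesis
          using ge[OF x0] below[OF 1] chord_lo[of u] u0 by (auto simp: u_def)
      next
        \<comment> \<open>The end points may or may not lie in \<open>I\<close>, but the chord meets
          \<open>\<phi>\<close> there and the first factor vanishes.\<close>
        case 2
        then have "\<phi> u = l u"
          using chord_in[of u] chord_lo[of u] chord_hi[of u] u0 ab by (auto intro: antisym)
        then show ?thesis by simp
      next
        case 3
        then show ?thesis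
          using less[of x] inside[OF 3] chord_in[of u] by (auto simp: u_def intro!: mult_nonpos_nonpos)
      next
        case 4
        then show ?thesis
          using ge[OF x0] above[OF 4] chord_hi[of u] by (auto simp: u_def)
      qed
      then show ?case by (simp add: u_def l_def)
    qed
    then show ?thesis
      by (intro nn_integral_le_by_affine) (auto simp: nn)
  next
    case unbdd: False
    have inside: "u \<in> I" if u: "a < u" for u
    proof -
      obtain v w where "v \<in> I" "v < u" "w \<in> I" "u < w"
        using cInf_lessD[OF ne, of u] u unbdd unfolding a_def bdd_above_def by (meson not_le)
      then show ?thesis
        using I(1) by (meson is_interval_1 less_imp_le)
    qed
    \<comment> \<open>With \<open>p \<le> q\<close> beyond \<open>a\<close> and
      \<open>q \<le> p\<close> below it, \<open>(a - |x|^2) * (p x - q x)\<close> is nonnegative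
      almost everywhere; its integral is zero by the equal moments, which forces
      \<open>p = q\<close> almost everywhere.\<close>
    let ?d = "\<lambda>x. ((- 1) * (norm x)\<^sup>2 + a) * (p x - q x)"
    have "AE x in lborel. 0 \<le> ?d x"
      using AE_lborel_norm_neq[of 0]
    proof eventually_elim
      case (elim x)
      show ?case
      proof (cases "a < (norm x)\<^sup>2")
        case True
        then show ?thesis
          using less[OF inside[OF True]] by (intro mult_nonpos_nonpos) auto
      next
        case False
        then have "(norm x)\<^sup>2 = a \<or> q x \<le> p x"
          using ge[of x] below[of "(norm x)\<^sup>2"] elim by fastforce
        then show ?thesis using False by auto
      qed
    qed
    then have "AE x in lborel. ?d x = 0"
      using integral_nonneg_eq_0_iff_AE[OF integral_affine(1)] integral_affine(2) by blast
    then have "AE x in lborel. p x = q x"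
      using AE_lborel_norm_neq[of "sqrt a"]
    proof eventually_elim
      case (elim x)
      then have "(norm x)\<^sup>2 \<noteq> a"
        by (metis norm_ge_zero real_sqrt_unique)
      then show ?case using elim by auto
    qed
    then show ?thesis
      by (intro nn_integral_mono_AE) (auto elim!: eventually_mono)
  qed
qed

end

section \<open>Centred Gaussian densities and their integrals\<close>

text \<open>The product form reduces the total mass to the one-dimensional normal density;
  \<open>gaussian_eq\<close> gives the closed radial form.\<close>

definition gaussian :: "real \<Rightarrow> 'a::euclidean_space \<Rightarrow> real" where
  "gaussian s x = (\<Prod>b\<in>Basis. normal_density 0 s (x \<bullet> b))"

lemma gaussian_measurable [measurable]: "gaussian s \<in> borel_measurable borel"
  unfolding gaussian_def[abs_def] by measurable

lemma gaussian_eq: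
  fixes x :: "'a::euclidean_space"
  assumes "0 < s"
  shows "gaussian s x = (2 * pi * s\<^sup>2) powr (- real DIM('a) / 2) * exp (- (norm x)\<^sup>2 / (2 * s\<^sup>2))"
proof -
  have "1 / sqrt (2 * pi * s\<^sup>2) = (2 * pi * s\<^sup>2) powr (- 1 / 2)"
    using assms powr_minus_divide[of "2 * pi * s\<^sup>2" "1 / 2"] by (simp add: powr_half_sqrt)
  then have "gaussian s x = (\<Prod>b\<in>(Basis::'a set). (2 * pi * s\<^sup>2) powr (- 1 / 2) * exp (- (x \<bullet> b)\<^sup>2 / (2 * s\<^sup>2)))"
    by (simp add: gaussian_def normal_density_def)
  also have "\<dots> = ((2 * pi * s\<^sup>2) powr (- 1 / 2)) ^ DIM('a) * exp (\<Sum>b\<in>(Basis::'a set). - (x \<bullet> b)\<^sup>2 / (2 * s\<^sup>2))"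
    by (simp add: prod.distrib exp_sum)
  also have "((2 * pi * s\<^sup>2) powr (- 1 / 2)) ^ DIM('a) = (2 * pi * s\<^sup>2) powr (- real DIM('a) / 2)"
    using assms by (simp add: powr_power mult.commute)
  also have "(\<Sum>b\<in>(Basis::'a set). - (x \<bullet> b)\<^sup>2 / (2 * s\<^sup>2)) = - (norm x)\<^sup>2 / (2 * s\<^sup>2)"
    unfolding power2_norm_eq_inner euclidean_inner[of x x]
    by (simp add: power2_eq_square sum_divide_distrib sum_negf)
  finally show ?thesis .
qed

lemma gaussian_nonneg: "0 \<le> gaussian s x"
  by (auto simp: gaussian_def intro!: prod_nonneg)

lemma nn_integral_gaussian:
  assumes "0 < s"
  shows "(\<integral>\<^sup>+ x. ennreal (gaussian s x) \<partial>(lborel :: 'a::euclidean_space measure)) = 1"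
proof -
  have "(\<integral>\<^sup>+ x. ennreal (normal_density 0 s x) \<partial>lborel) = 1"
    using prob_space.emeasure_space_1[OF prob_space_normal_density[OF assms, of 0]]
    by (simp add: emeasure_density)
  then have "(\<integral>\<^sup>+ x. (\<Prod>b\<in>(Basis::'a set). ennreal (normal_density 0 s (x \<bullet> b))) \<partial>lborel) = 1"
    by (subst nn_integral_lborel_prod) auto
  then show ?thesis
    by (simp add: gaussian_def prod_ennreal)
qed

lemma std_gaussian_pdf_eq: "std_gaussian_pdf = gaussian 1"
  by (rule ext) (simp add: std_gaussian_pdf_def gaussian_eq)

text \<open>Substituting \<open>s *\<^sub>R x\<close> for \<open>x\<close> extracts the factor.
  Every positive finite second moment is therefore attained by some \<open>s\<close>.\<close>

lemma gaussian_second_moment: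
  assumes "0 < s"
  shows "(\<integral>\<^sup>+ x. ennreal ((norm x)\<^sup>2 * gaussian s x) \<partial>(lborel :: 'a::euclidean_space measure))
    = ennreal (s\<^sup>2) * (\<integral>\<^sup>+ x. ennreal ((norm x)\<^sup>2 * gaussian 1 x) \<partial>(lborel :: 'a measure))"
proof -
  have sc: "s ^ DIM('a) * gaussian s (s *\<^sub>R x) = gaussian 1 x" for x :: 'a
  proof -
    have "s ^ DIM('a) * (2 * pi * s\<^sup>2) powr (- real DIM('a) / 2) = (2 * pi) powr (- real DIM('a) / 2)"
    proof -
      have "(s\<^sup>2) powr (- real DIM('a) / 2) = s powr (- real DIM('a))"
        using assms by (simp add: powr_realpow[symmetric] powr_powr del: powr_numeral)
      then show ?thesis
        using assms by (simp add: powr_mult powr_minus powr_realpow field_simps)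
    qed
    then show ?thesis
      using assms by (simp add: gaussian_eq power_mult_distrib)
  qed
  have "(\<integral>\<^sup>+ x. ennreal ((norm x)\<^sup>2 * gaussian s x) \<partial>(lborel :: 'a measure))
     = ennreal (s ^ DIM('a)) * (\<integral>\<^sup>+ x. ennreal ((norm (s *\<^sub>R x))\<^sup>2 * gaussian s (s *\<^sub>R x)) \<partial>(lborel :: 'a measure))"
    using nn_integral_lborel_affine[of "\<lambda>x::'a. ennreal ((norm x)\<^sup>2 * gaussian s x)" s 0] assms by simp
  also have "\<dots> = (\<integral>\<^sup>+ x. ennreal (s\<^sup>2 * ((norm x)\<^sup>2 * (s ^ DIM('a) * gaussian s (s *\<^sub>R x)))) \<partial>(lborel :: 'a measure))"
    using assms by (subst nn_integral_cmult[symmetric])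
      (auto simp: ennreal_mult'[symmetric] power_mult_distrib ac_simps)
  also have "\<dots> = ennreal (s\<^sup>2) * (\<integral>\<^sup>+ x. ennreal ((norm x)\<^sup>2 * gaussian 1 x) \<partial>(lborel :: 'a measure))"
    unfolding sc by (subst nn_integral_cmult[symmetric]) (auto simp: ennreal_mult')
  finally show ?thesis .
qed

text \<open>The factor \<open>|x|^2\<close> is absorbed by doubling the variance, using
  \<open>y \<le> exp y\<close> at \<open>y = |x|^2 / 4\<close>.\<close>

lemma gaussian_second_moment_finite:
  "(\<integral>\<^sup>+ x. ennreal ((norm x)\<^sup>2 * gaussian 1 x) \<partial>(lborel :: 'a::euclidean_space measure)) < \<infinity>"
proof -
  define c where "c = (2 * pi) powr (- real DIM('a) / 2)"
  define d where "d = (2 * pi * (sqrt 2)\<^sup>2) powr (- real DIM('a) / 2)"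
  have cd: "0 < c" "0 < d" by (auto simp: c_def d_def)
  have "(norm x)\<^sup>2 * gaussian 1 x \<le> (4 * c / d) * gaussian (sqrt 2) x" for x :: 'a
  proof -
    define y where "y = (norm x)\<^sup>2 / 4"
    have "y \<le> exp y"
      using exp_ge_add_one_self[of y] by linarith
    then have "y * exp (- (2 * y)) \<le> exp y * exp (- (2 * y))"
      by (intro mult_right_mono) auto
    also have "\<dots> = exp (- y)"
      by (simp add: exp_add[symmetric])
    finally have "4 * y * (c * exp (- (2 * y))) \<le> 4 * c * exp (- y)"
      using cd by simp
    moreover have "gaussian 1 x = c * exp (- (2 * y))" "gaussian (sqrt 2) x = d * exp (- y)"
      by (simp_all add: gaussian_eq c_def d_def y_def)
    ultimately show ?thesis
      using cd by (simp add: y_def)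
  qed
  then have "(\<integral>\<^sup>+ x. ennreal ((norm x)\<^sup>2 * gaussian 1 x) \<partial>(lborel :: 'a measure))
      \<le> (\<integral>\<^sup>+ x. ennreal (4 * c / d) * ennreal (gaussian (sqrt 2) x) \<partial>(lborel :: 'a measure))"
    using cd by (intro nn_integral_mono) (auto simp: ennreal_mult'[symmetric] intro: ennreal_leI)
  also have "\<dots> = ennreal (4 * c / d)"
    by (subst nn_integral_cmult) (auto simp: nn_integral_gaussian)
  finally show ?thesis
    by (simp add: le_less_trans)
qed

text \<open>A vanishing second moment would force \<open>f\<close> to vanish almost everywhere away
  from the origin, a null set.\<close>

lemma second_moment_pos:
  fixes f :: "'a::euclidean_space \<Rightarrow> real"
  assumes [measurable]: "f \<in> borel_measurable borel" and nn: "\<And>x. 0 \<le> f x"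
    and "(\<integral>\<^sup>+ x. ennreal (f x) \<partial>lborel) = 1"
  shows "0 < (\<integral>\<^sup>+ x. ennreal ((norm x)\<^sup>2 * f x) \<partial>lborel)"
proof (rule ccontr)
  assume "\<not> ?thesis"
  then have "AE x in lborel. ennreal ((norm x)\<^sup>2 * f x) = 0"
    by (subst nn_integral_0_iff_AE[symmetric]) auto
  then have "AE x in lborel. ennreal (f x) = 0"
    using AE_lborel_norm_neq[of 0]
    by eventually_elim (use nn in \<open>auto simp: ennreal_eq_0_iff mult_le_0_iff\<close>)
  then have "(\<integral>\<^sup>+ x. ennreal (f x) \<partial>lborel) = 0"
    by (subst nn_integral_0_iff_AE) auto
  then show False using assms by simp
qed

text \<open>Completing the square turns the exponential tilt into a shift by
  \<open>s\<^sup>2 *\<^sub>R \<xi>\<close> and a constant factor.\<close>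

lemma nn_integral_exp_gaussian:
  fixes \<xi> :: "'a::euclidean_space"
  assumes "0 < s"
  shows "(\<integral>\<^sup>+ x. ennreal (exp (x \<bullet> \<xi>) * gaussian s x) \<partial>lborel) = ennreal (exp (s\<^sup>2 * (norm \<xi>)\<^sup>2 / 2))"
proof -
  have "exp (x \<bullet> \<xi>) * gaussian s x = exp (s\<^sup>2 * (norm \<xi>)\<^sup>2 / 2) * gaussian s (- (s\<^sup>2 *\<^sub>R \<xi>) + x)" for x
  proof -
    have "(norm (- (s\<^sup>2 *\<^sub>R \<xi>) + x))\<^sup>2 = s\<^sup>2 * s\<^sup>2 * (norm \<xi>)\<^sup>2 - 2 * s\<^sup>2 * (x \<bullet> \<xi>) + (norm x)\<^sup>2"
      unfolding power2_norm_eq_inner by (simp add: inner_simps inner_commute)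
    then have "x \<bullet> \<xi> + - (norm x)\<^sup>2 / (2 * s\<^sup>2)
        = s\<^sup>2 * (norm \<xi>)\<^sup>2 / 2 + - (norm (- (s\<^sup>2 *\<^sub>R \<xi>) + x))\<^sup>2 / (2 * s\<^sup>2)"
      using assms by (simp add: field_simps power2_eq_square)
    then show ?thesis
      using assms by (simp add: gaussian_eq exp_add[symmetric])
  qed
  then have "(\<integral>\<^sup>+ x. ennreal (exp (x \<bullet> \<xi>) * gaussian s x) \<partial>lborel)
     = (\<integral>\<^sup>+ x. ennreal (exp (s\<^sup>2 * (norm \<xi>)\<^sup>2 / 2)) * ennreal (gaussian s (- (s\<^sup>2 *\<^sub>R \<xi>) + x)) \<partial>lborel)"
    by (simp add: ennreal_mult')
  also have "\<dots> = ennreal (exp (s\<^sup>2 * (norm \<xi>)\<^sup>2 / 2)) * (\<integral>\<^sup>+ x. ennreal (gaussian s (- (s\<^sup>2 *\<^sub>R \<xi>) + x)) \<partial>lborel)"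
    by (rule nn_integral_cmult) measurable
  also have "(\<integral>\<^sup>+ x. ennreal (gaussian s (- (s\<^sup>2 *\<^sub>R \<xi>) + x)) \<partial>lborel) = 1"
    by (subst nn_integral_lborel_shift) (auto simp: nn_integral_gaussian assms)
  finally show ?thesis by simp
qed

text \<open>The integrand is a constant multiple of the Gaussian with parameter
  \<open>s / sqrt 2\<close>; the ratio of the normalising constants no longer involves
  \<open>s\<close>.\<close>

lemma nn_integral_exp_neg_gaussian:
  assumes "0 < s"
  shows "(\<integral>\<^sup>+ x. ennreal (exp (- (norm x)\<^sup>2 / (2 * s\<^sup>2)) * gaussian s x) \<partial>(lborel :: 'a::euclidean_space measure))
     = ennreal (2 powr (- real DIM('a) / 2))"
proof -
  have "exp (- (norm x)\<^sup>2 / (2 * s\<^sup>2)) * gaussian s x = 2 powr (- real DIM('a) / 2) * gaussian (s / sqrt 2) x" for x :: 'a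
  proof -
    define A where "A = (2 * pi * s\<^sup>2) powr (- real DIM('a) / 2)"
    define B where "B = (2 * pi * (s / sqrt 2)\<^sup>2) powr (- real DIM('a) / 2)"
    define E where "E = exp (- (norm x)\<^sup>2 / (2 * s\<^sup>2))"
    have "2 powr (- real DIM('a) / 2) * B = A"
      unfolding A_def B_def using assms
      by (subst powr_mult[symmetric]) (auto simp: power_divide mult.assoc)
    moreover have "gaussian s x = A * E"
      using assms by (simp add: gaussian_eq A_def E_def)
    moreover have "gaussian (s / sqrt 2) x = B * (E * E)"
      using assms by (simp add: gaussian_eq B_def E_def exp_add[symmetric] power_divide)
    ultimately show ?thesis
      unfolding E_def[symmetric] by (simp add: mult_ac)
  qed
  then show ?thesis
    using assms by (simp add: ennreal_mult' nn_integral_cmult nn_integral_gaussian)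
qed

section \<open>Decay and finite second moment of radial log-concave densities\<close>

text \<open>The maximum is at the origin, the midpoint of \<open>x\<close> and \<open>- x\<close>.
  Some \<open>a\<close> has a strictly smaller value, and concavity of the logarithm along rays
  turns this drop into exponential decay beyond radius \<open>norm a\<close>.\<close>

lemma radial_log_concave_bounds:
  fixes f :: "'a::euclidean_space \<Rightarrow> real"
  assumes f [measurable]: "f \<in> borel_measurable borel" and nn: "\<And>x. 0 \<le> f x"
    and prob: "(\<integral>\<^sup>+ x. ennreal (f x) \<partial>lborel) = 1"
    and radial: "\<And>x. f x = g (norm x)" and lc: "log_concave_fun f UNIV"
  shows "0 < f 0" and "\<exists>K. \<forall>x. (norm x)\<^sup>2 * f x \<le> K"
proof -
  have lcD: "f x powr (1 - t) * f y powr t \<le> f ((1 - t) *\<^sub>R x + t *\<^sub>R y)" if "0 < t" "t < 1" for x y t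
    using lc that by (auto simp: log_concave_fun_def)
  have le0: "f x \<le> f 0" for x
  proof -
    have "f (- x) = f x" by (simp add: radial)
    then have "f x powr (1 / 2) * f x powr (1 / 2) \<le> f 0"
      using lcD[of "1/2" x "- x"] by simp
    then show ?thesis
      using nn[of x] by (simp add: powr_half_sqrt)
  qed
  show pos: "0 < f 0"
  proof (rule ccontr)
    assume "\<not> 0 < f 0"
    then have "f x = 0" for x
      using le0[of x] nn[of x] by linarith
    then show False using prob by simp
  qed
  \<comment> \<open>Otherwise \<open>f\<close> would be a positive constant, whose integral over the
    whole space is infinite.\<close>
  have "\<exists>x. f x < f 0"
  proof (rule ccontr)
    assume "\<not> ?thesis"
    then have "f 0 = f x" for x
      using le0[of x] by (simp add: not_less antisym)
    then have "(\<integral>\<^sup>+ x. ennreal (f 0) \<partial>(lborel :: 'a measure)) = (\<integral>\<^sup>+ x. ennreal (f x) \<partial>lborel)"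
      by (intro nn_integral_cong arg_cong[where f=ennreal])
    then have "(\<integral>\<^sup>+ x. ennreal (f 0) \<partial>(lborel :: 'a measure)) = 1"
      using prob by simp
    then show False
      using pos by (simp add: ennreal_mult_top ennreal_eq_0_iff)
  qed
  then obtain a where a: "f a < f 0" by blast
  then have a0: "0 < norm a" by auto
  \<comment> \<open>The drop of \<open>ln f\<close> from the origin to \<open>a\<close>. The value 1
    is a placeholder: if \<open>f a = 0\<close>, then \<open>f\<close> vanishes at every radius
    beyond \<open>norm a\<close>.\<close>
  define \<delta> where "\<delta> = (if f a = 0 then 1 else ln (f 0) - ln (f a))"
  have \<delta>: "0 < \<delta>"
    using a pos nn[of a] by (auto simp: \<delta>_def)
  define c where "c = \<delta> / norm a"
  have c: "0 < c" using \<delta> a0 by (simp add: c_def)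
  have decay: "f x \<le> f 0 * exp (- (c * norm x))" if x: "norm a < norm x" for x
  proof (cases "f x = 0")
    case False
    then have fx: "0 < f x" using nn[of x] by simp
    \<comment> \<open>The point \<open>t *\<^sub>R x\<close> lies between 0 and \<open>x\<close> at
      the radius of \<open>a\<close>, so radiality gives it the value \<open>f a\<close>.\<close>
    define t where "t = norm a / norm x"
    have t: "0 < t" "t < 1"
      unfolding t_def using x a0 order_less_trans[OF a0 x]
      by (simp_all only: divide_pos_pos divide_less_eq_1_pos)
    have "norm (t *\<^sub>R x) = norm a"
      using order_less_trans[OF a0 x] by (simp add: t_def)
    then have "f (t *\<^sub>R x) = f a" by (simp add: radial)
    then have le: "f 0 powr (1 - t) * f x powr t \<le> f a"
      using lcD[OF t, of 0 x] by simp
    have fa: "0 < f a"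
      using le pos fx by (smt (verit) mult_pos_pos powr_gt_zero)
    have "ln (f 0 powr (1 - t) * f x powr t) \<le> ln (f a)"
      using le pos fx fa by (subst ln_le_cancel_iff) auto
    then have "(1 - t) * ln (f 0) + t * ln (f x) \<le> ln (f a)"
      using pos fx by (simp add: ln_mult ln_powr)
    then have "\<delta> \<le> t * (ln (f 0) - ln (f x))"
      using fa by (simp add: \<delta>_def algebra_simps)
    then have "\<delta> / t \<le> ln (f 0) - ln (f x)"
      using t by (simp add: divide_le_eq mult.commute)
    moreover have "\<delta> / t = c * norm x"
      using a0 by (simp add: t_def c_def)
    ultimately have "ln (f x) \<le> ln (f 0) + - (c * norm x)" by simp
    then have "exp (ln (f x)) \<le> exp (ln (f 0) + - (c * norm x))" by (simp only: exp_le_cancel_iff)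
    then show ?thesis
      by (simp only: exp_add exp_ln[OF pos] exp_ln[OF fx])
  qed (use pos in simp)
  show "\<exists>K. \<forall>x. (norm x)\<^sup>2 * f x \<le> K"
  proof (intro exI allI)
    fix x :: 'a
    have "(norm x)\<^sup>2 * f x \<le> (norm a)\<^sup>2 * f 0 \<or> (norm x)\<^sup>2 * f x \<le> 2 * f 0 / c\<^sup>2"
    proof (cases "norm a < norm x")
      case True
      define y where "y = c * norm x"
      have y: "0 \<le> y" using c by (simp add: y_def)
      have "y\<^sup>2 \<le> 2 * exp y"
        using exp_lower_Taylor_quadratic[OF y] y by linarith
      then have "y\<^sup>2 * exp (- y) \<le> (2 * exp y) * exp (- y)"
        by (intro mult_right_mono) auto
      then have y2: "y\<^sup>2 * exp (- y) \<le> 2"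
        by (simp add: mult.assoc exp_add[symmetric])
      have "c\<^sup>2 * ((norm x)\<^sup>2 * f x) \<le> y\<^sup>2 * (f 0 * exp (- y))"
        using mult_left_mono[OF decay[OF True], of "y\<^sup>2"] by (simp add: y_def power_mult_distrib mult.assoc)
      also have "\<dots> \<le> f 0 * 2"
        using mult_left_mono[OF y2, of "f 0"] pos by (simp add: ac_simps)
      finally show ?thesis
        using c by (simp add: field_simps)
    next
      case False
      then show ?thesis
        using le0[of x] nn[of x] by (intro disjI1 mult_mono power_mono) auto
    qed
    then show "(norm x)\<^sup>2 * f x \<le> max ((norm a)\<^sup>2 * f 0) (2 * f 0 / c\<^sup>2)"
      by linarith
  qed
qed

text \<open>Since \<open>x\<close> is the midpoint of 0 and \<open>2 *\<^sub>R x\<close>,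
  log-concavity bounds \<open>f (2 *\<^sub>R x)\<close> by the square of \<open>f x\<close> over
  \<open>f 0\<close>. After rescaling by 2, one factor \<open>f x\<close> tames \<open>|x|^2\<close>
  through the bound \<open>K\<close>, and the other is integrable.\<close>

lemma radial_log_concave_second_moment_finite:
  fixes f :: "'a::euclidean_space \<Rightarrow> real"
  assumes f [measurable]: "f \<in> borel_measurable borel" and nn: "\<And>x. 0 \<le> f x"
    and prob: "(\<integral>\<^sup>+ x. ennreal (f x) \<partial>lborel) = 1"
    and radial: "\<And>x. f x = g (norm x)" and lc: "log_concave_fun f UNIV"
  shows "(\<integral>\<^sup>+ x. ennreal ((norm x)\<^sup>2 * f x) \<partial>lborel) < \<infinity>"
proof -
  note pos = radial_log_concave_bounds(1)[OF assms]
  obtain K where K: "\<And>x. (norm x)\<^sup>2 * f x \<le> K"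
    using radial_log_concave_bounds(2)[OF assms] by blast
  have K0: "0 \<le> K" using K[of 0] by simp
  have lcD: "f x powr (1 - t) * f y powr t \<le> f ((1 - t) *\<^sub>R x + t *\<^sub>R y)" if "0 < t" "t < 1" for x y t
    using lc that by (auto simp: log_concave_fun_def)
  have double: "f (2 *\<^sub>R x) \<le> (f x)\<^sup>2 / f 0" for x
  proof -
    have "f 0 powr (1 - 1 / 2) * f (2 *\<^sub>R x) powr (1 / 2) \<le> f x"
      using lcD[of "1 / 2" 0 "2 *\<^sub>R x"] by simp
    then have "sqrt (f 0 * f (2 *\<^sub>R x)) \<le> f x"
      using pos nn by (simp add: powr_half_sqrt real_sqrt_mult)
    then have "f 0 * f (2 *\<^sub>R x) \<le> (f x)\<^sup>2"
      by (rule sqrt_le_D)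
    then show ?thesis
      using pos by (simp add: field_simps)
  qed
  have "(\<integral>\<^sup>+ x. ennreal ((norm x)\<^sup>2 * f x) \<partial>lborel)
      = ennreal (2 ^ DIM('a)) * (\<integral>\<^sup>+ x. ennreal ((norm (2 *\<^sub>R x))\<^sup>2 * f (2 *\<^sub>R x)) \<partial>lborel)"
    using nn_integral_lborel_affine[of "\<lambda>x. ennreal ((norm x)\<^sup>2 * f x)" 2 0] by simp
  also have "\<dots> \<le> ennreal (2 ^ DIM('a)) * (\<integral>\<^sup>+ x. ennreal (4 * K / f 0) * ennreal (f x) \<partial>lborel)"
  proof (intro mult_left_mono nn_integral_mono)
    fix x :: 'a
    have "(norm (2 *\<^sub>R x))\<^sup>2 * f (2 *\<^sub>R x) \<le> (4 * (norm x)\<^sup>2) * ((f x)\<^sup>2 / f 0)"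
      using mult_left_mono[OF double[of x], of "4 * (norm x)\<^sup>2"] by (simp add: power_mult_distrib)
    also have "\<dots> = ((norm x)\<^sup>2 * f x) * (4 * f x / f 0)"
      by (simp add: power2_eq_square)
    also have "\<dots> \<le> K * (4 * f x / f 0)"
      using pos nn by (intro mult_right_mono K) auto
    finally show "ennreal ((norm (2 *\<^sub>R x))\<^sup>2 * f (2 *\<^sub>R x)) \<le> ennreal (4 * K / f 0) * ennreal (f x)"
      using K0 pos nn by (simp add: ennreal_mult'[symmetric] ac_simps ennreal_leI)
  qed simp
  also have "\<dots> < \<infinity>"
    using prob by (simp add: nn_integral_cmult ennreal_mult_less_top)
  finally show ?thesis .
qed

section \<open>Monotonicity of the Cramer transform and its Gaussian value\<close>

text \<open>Positivity keeps the argument of \<open>ln\<close> away from 0, where its value is only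
  a convention; an infinite integral for \<open>Q\<close> makes the bound trivial.\<close>

lemma log_mgf_mono:
  assumes "0 < (\<integral>\<^sup>+ x. ennreal (exp (x \<bullet> \<xi>)) \<partial>P)"
    and "(\<integral>\<^sup>+ x. ennreal (exp (x \<bullet> \<xi>)) \<partial>P) \<le> (\<integral>\<^sup>+ x. ennreal (exp (x \<bullet> \<xi>)) \<partial>Q)"
  shows "log_mgf P \<xi> \<le> log_mgf Q \<xi>"
proof (cases "(\<integral>\<^sup>+ x. ennreal (exp (x \<bullet> \<xi>)) \<partial>Q) = \<infinity>")
  case False
  then have "(\<integral>\<^sup>+ x. ennreal (exp (x \<bullet> \<xi>)) \<partial>P) < \<infinity>"
    using assms(2) by (simp add: less_top top_unique)
  then show ?thesis
    using assms False
    by (auto simp: log_mgf_def Let_def enn2real_positive_iff less_top intro!: ln_mono enn2real_mono)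
qed (simp add: log_mgf_def)

lemma cramer_antimono:
  assumes "\<And>\<xi>. log_mgf P \<xi> \<le> log_mgf Q \<xi>"
  shows "cramer Q x \<le> cramer P x"
  unfolding cramer_def by (intro SUP_mono' ereal_minus_mono assms order_refl)

lemma exp_neg_ereal_antimono: "y \<le> z \<Longrightarrow> exp_neg_ereal z \<le> exp_neg_ereal y"
  by (cases y; cases z) (auto simp: exp_neg_ereal_def intro!: ennreal_leI)

text \<open>The logarithmic moment generating function is \<open>s^2 * |\<xi>|^2 / 2\<close>.
  Completing the square shows that the claimed supremum exceeds the objective at
  \<open>\<xi>\<close> by \<open>|x - s^2 \<xi>|^2 / (2 s^2)\<close>.\<close>

lemma cramer_gaussian:
  fixes x :: "real ^ 'n::finite"
  assumes "0 < s"
  shows "cramer (density lborel (\<lambda>x. ennreal (gaussian s x))) x = ereal ((norm x)\<^sup>2 / (2 * s\<^sup>2))"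
proof -
  have "log_mgf (density lborel (\<lambda>x. ennreal (gaussian s x))) \<xi> = ereal (s\<^sup>2 * (norm \<xi>)\<^sup>2 / 2)" for \<xi> :: "real ^ 'n"
    using nn_integral_exp_gaussian[OF assms, of \<xi>]
    by (simp add: log_mgf_def nn_integral_density ennreal_mult'[symmetric] gaussian_nonneg mult.commute)
  then have eq: "cramer (density lborel (\<lambda>x. ennreal (gaussian s x))) x = (SUP \<xi>. ereal (x \<bullet> \<xi> - s\<^sup>2 * (norm \<xi>)\<^sup>2 / 2))"
    by (simp add: cramer_def)
  have div: "(X - 2 * w * Y + w * w * Z) / (2 * w) = X / (2 * w) - Y + w * Z / 2" if "w \<noteq> 0" for w X Y Z :: real
    using that by (simp add: field_simps)
  show ?thesis
    unfolding eq
  proof (rule SUP_eqI)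
    fix \<xi> :: "real ^ 'n"
    have "0 \<le> (norm (x - s\<^sup>2 *\<^sub>R \<xi>))\<^sup>2 / (2 * s\<^sup>2)" by simp
    also have "(norm (x - s\<^sup>2 *\<^sub>R \<xi>))\<^sup>2 = (norm x)\<^sup>2 - 2 * s\<^sup>2 * (x \<bullet> \<xi>) + s\<^sup>2 * s\<^sup>2 * (norm \<xi>)\<^sup>2"
      unfolding power2_norm_eq_inner by (simp add: inner_simps inner_commute)
    also have "\<dots> / (2 * s\<^sup>2) = (norm x)\<^sup>2 / (2 * s\<^sup>2) - (x \<bullet> \<xi>) + s\<^sup>2 * (norm \<xi>)\<^sup>2 / 2"
      using div[of "s\<^sup>2"] assms by simp
    finally show "ereal (x \<bullet> \<xi> - s\<^sup>2 * (norm \<xi>)\<^sup>2 / 2) \<le> ereal ((norm x)\<^sup>2 / (2 * s\<^sup>2))"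
      by simp
  next
    fix y
    assume "\<And>i. i \<in> UNIV \<Longrightarrow> ereal (x \<bullet> i - s\<^sup>2 * (norm i)\<^sup>2 / 2) \<le> y"
    \<comment> \<open>The maximiser, where the completed square vanishes.\<close>
    from this[of "x /\<^sub>R s\<^sup>2"]
    have "ereal (x \<bullet> (x /\<^sub>R s\<^sup>2) - s\<^sup>2 * (norm (x /\<^sub>R s\<^sup>2))\<^sup>2 / 2) \<le> y" by simp
    moreover have "x \<bullet> (x /\<^sub>R s\<^sup>2) - s\<^sup>2 * (norm (x /\<^sub>R s\<^sup>2))\<^sup>2 / 2 = (norm x)\<^sup>2 / (2 * s\<^sup>2)"
    proof -
      have "x \<bullet> (x /\<^sub>R s\<^sup>2) = (norm x)\<^sup>2 / s\<^sup>2"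
        by (simp add: power2_norm_eq_inner divide_inverse mult.commute)
      moreover have "s\<^sup>2 * (norm (x /\<^sub>R s\<^sup>2))\<^sup>2 = (norm x)\<^sup>2 / s\<^sup>2"
        using assms by (simp add: power_mult_distrib field_simps)
      ultimately show ?thesis by simp
    qed
    ultimately show "ereal ((norm x)\<^sup>2 / (2 * s\<^sup>2)) \<le> y" by simp
  qed
qed

text \<open>The mixed quantity, with the transform of the Gaussian averaged under the law of
  \<open>f\<close>, is the middle term between the two Cramer means to be compared.\<close>

lemma nn_integral_exp_neg_cramer_gaussian:
  fixes f :: "real ^ 'n::finite \<Rightarrow> real"
  assumes [measurable]: "f \<in> borel_measurable borel" and "0 < s"
  shows "(\<integral>\<^sup>+ x. exp_neg_ereal (cramer (density lborel (\<lambda>x. ennreal (gaussian s x))) x) \<partial>density lborel (\<lambda>x. ennreal (f x)))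
     = (\<integral>\<^sup>+ x. ennreal (exp (- (norm x)\<^sup>2 / (2 * s\<^sup>2)) * f x) \<partial>lborel)"
  using assms by (simp add: cramer_gaussian exp_neg_ereal_def nn_integral_density ennreal_mult'' mult.commute)

lemma cramer_mean_gaussian:
  assumes "0 < s"
  shows "cramer_mean (density lborel (\<lambda>x :: real ^ 'n::finite. ennreal (gaussian s x))) = ennreal (2 powr (- real CARD('n) / 2))"
  using nn_integral_exp_neg_gaussian[OF assms, where 'a="real ^ 'n"]
  by (simp add: cramer_mean_def nn_integral_exp_neg_cramer_gaussian assms)

section \<open>Consequences of the convex order for exponential integrals\<close>

text \<open>Each even radial moment integrates a power \<open>u ^ k\<close> of
  \<open>u = |x|^2\<close>, which is convex for \<open>u \<ge> 0\<close>. The convex order therefore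
  compares all coefficients of the two series at once.\<close>

lemma same_mass_moment_mgf_le:
  fixes p q :: "real ^ 'n::finite \<Rightarrow> real"
  assumes pq: "same_mass_moment p q"
    and p: "\<And>x. p x = g (norm x)" and q: "\<And>x. q x = h (norm x)"
    and I: "is_interval I" "I \<subseteq> {0<..}"
    and less: "\<And>x. (norm x)\<^sup>2 \<in> I \<Longrightarrow> p x \<le> q x"
    and ge: "\<And>x. x \<noteq> 0 \<Longrightarrow> (norm x)\<^sup>2 \<notin> I \<Longrightarrow> q x \<le> p x"
  shows "(\<integral>\<^sup>+ x. ennreal (exp (x \<bullet> \<xi>) * q x) \<partial>lborel) \<le> (\<integral>\<^sup>+ x. ennreal (exp (x \<bullet> \<xi>) * p x) \<partial>lborel)"
proof -
  interpret same_mass_moment p q by (rule pq)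
  show ?thesis
  proof (rule nn_integral_exp_radial_mono[OF q_meas q_nonneg q p_meas p_nonneg p])
    fix m :: nat
    assume "even m"
    then obtain k where m: "m = 2 * k" by blast
    have convex: "convex_on {0..} (\<lambda>u::real. u ^ k)"
      by (cases "even k") (auto intro: convex_power_odd convex_on_subset[OF convex_power_even])
    have "(\<integral>\<^sup>+ x. ennreal (((norm x)\<^sup>2) ^ k * q x) \<partial>lborel) \<le> (\<integral>\<^sup>+ x. ennreal (((norm x)\<^sup>2) ^ k * p x) \<partial>lborel)"
      by (rule convex_order[where \<phi>="\<lambda>u. u ^ k", OF I _ _ convex]) (erule less, erule (1) ge, auto)
    then show "(\<integral>\<^sup>+ x. ennreal (norm x ^ m * q x) \<partial>lborel) \<le> (\<integral>\<^sup>+ x. ennreal (norm x ^ m * p x) \<partial>lborel)"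
      by (simp add: m power_mult)
  qed
qed

text \<open>Although decreasing, \<open>exp (- u / c)\<close> is convex in \<open>u\<close>, so it
  compares in the same direction as the powers.\<close>

lemma (in same_mass_moment) exp_neg_square_le:
  assumes c: "0 < c" and I: "is_interval I" "I \<subseteq> {0<..}"
    and less: "\<And>x. (norm x)\<^sup>2 \<in> I \<Longrightarrow> p x \<le> q x"
    and ge: "\<And>x. x \<noteq> 0 \<Longrightarrow> (norm x)\<^sup>2 \<notin> I \<Longrightarrow> q x \<le> p x"
  shows "(\<integral>\<^sup>+ x. ennreal (exp (- (norm x)\<^sup>2 / c) * q x) \<partial>lborel) \<le> (\<integral>\<^sup>+ x. ennreal (exp (- (norm x)\<^sup>2 / c) * p x) \<partial>lborel)"
proof -
  have convex: "convex_on {0..} (\<lambda>u::real. exp (- u / c))"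
    by (rule f''_ge0_imp_convex[where f'="\<lambda>u. (- 1 / c) * exp (- u / c)" and f''="\<lambda>u. (1 / c\<^sup>2) * exp (- u / c)"])
       (use c in \<open>auto intro!: derivative_eq_intros simp: power2_eq_square\<close>)
  show ?thesis
    by (rule convex_order[where \<phi>="\<lambda>u. exp (- u / c)", OF I _ _ convex]) (erule less, erule (1) ge, auto)
qed

section \<open>Intervals on which a profile lies on one side of a Gaussian\<close>

text \<open>A log-affine function is the equality case of both log-convexity and
  log-concavity.\<close>

lemma exp_affine_geometric:
  fixes C c a b t :: real
  assumes "0 < C"
  shows "(C * exp (- c * a)) powr (1 - t) * (C * exp (- c * b)) powr t = C * exp (- c * ((1 - t) * a + t * b))"
proof -
  have "(C * exp (- c * a)) powr (1 - t) * (C * exp (- c * b)) powr t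
     = (C powr (1 - t) * C powr t) * (exp (- c * a * (1 - t)) * exp (- c * b * t))"
    using assms by (simp add: powr_mult exp_powr_real ac_simps)
  also have "C powr (1 - t) * C powr t = C"
    using assms by (simp add: powr_add[symmetric])
  finally show ?thesis
    by (simp add: exp_add[symmetric] algebra_simps)
qed

text \<open>The log-convexity and log-concavity conditions speak only of weights strictly between 0
  and 1; the end weights are settled here for both uses.\<close>

lemma is_interval_geometric:
  fixes P :: "real \<Rightarrow> bool"
  assumes "\<And>a b t. 0 < a \<Longrightarrow> 0 < b \<Longrightarrow> P a \<Longrightarrow> P b \<Longrightarrow> 0 < t \<Longrightarrow> t < 1 \<Longrightarrow> P ((1 - t) * a + t * b)"
  shows "is_interval {u. 0 < u \<and> P u}"
  unfolding is_interval_convex_1 convex_alt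
proof (intro ballI allI impI)
  fix a b t :: real
  assume ab: "a \<in> {u. 0 < u \<and> P u}" "b \<in> {u. 0 < u \<and> P u}" and t: "0 \<le> t \<and> t \<le> 1"
  consider "t = 0" | "t = 1" | "0 < t" "t < 1" using t by linarith
  then show "(1 - t) *\<^sub>R a + t *\<^sub>R b \<in> {u. 0 < u \<and> P u}"
  proof cases
    case 3
    then have "0 < (1 - t) * a + t * b"
      using ab by (intro add_pos_pos mult_pos_pos) auto
    then show ?thesis using assms[of a b t] ab 3 by auto
  qed (use ab in auto)
qed

text \<open>Strict inequality at two points passes to their weighted geometric means; the mean for
  \<open>h\<close> bounds \<open>h\<close> from above, and the mean for the Gaussian profile is its
  exact value.\<close>

lemma is_interval_log_convex_less:
  assumes "log_convex_fun h {0<..}" and nn: "\<And>u. 0 < u \<Longrightarrow> 0 \<le> h u" and C: "0 < C"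
  shows "is_interval {u. 0 < u \<and> h u < C * exp (- c * u)}"
proof (rule is_interval_geometric)
  fix a b t :: real
  assume A: "0 < a" "0 < b" "h a < C * exp (- c * a)" "h b < C * exp (- c * b)" "0 < t" "t < 1"
  have "h ((1 - t) * a + t * b) \<le> h a powr (1 - t) * h b powr t"
    using assms(1) A by (auto simp: log_convex_fun_def)
  also have "\<dots> < (C * exp (- c * a)) powr (1 - t) * (C * exp (- c * b)) powr t"
    using A nn by (intro mult_strict_mono' powr_less_mono2) auto
  finally show "h ((1 - t) * a + t * b) < C * exp (- c * ((1 - t) * a + t * b))"
    by (simp only: exp_affine_geometric[OF C])
qed

text \<open>The mirror image: the geometric mean now bounds \<open>h\<close> from below.\<close>

lemma is_interval_log_concave_greater:
  assumes "log_concave_fun h {0<..}" and C: "0 < C"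
  shows "is_interval {u. 0 < u \<and> C * exp (- c * u) < h u}"
proof (rule is_interval_geometric)
  fix a b t :: real
  assume A: "0 < a" "0 < b" "C * exp (- c * a) < h a" "C * exp (- c * b) < h b" "0 < t" "t < 1"
  have "C * exp (- c * ((1 - t) * a + t * b)) = (C * exp (- c * a)) powr (1 - t) * (C * exp (- c * b)) powr t"
    by (simp only: exp_affine_geometric[OF C])
  also have "\<dots> < h a powr (1 - t) * h b powr t"
    using A C by (intro mult_strict_mono' powr_less_mono2) auto
  also have "\<dots> \<le> h ((1 - t) * a + t * b)"
    using assms(1) A by (auto simp: log_concave_fun_def)
  finally show "C * exp (- c * ((1 - t) * a + t * b)) < h ((1 - t) * a + t * b)" .
qed

text \<open>Supplies the positivity required by \<open>log_mgf_mono\<close>: the exponential never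
  vanishes, so a zero integral would make \<open>f\<close> zero almost everywhere.\<close>

lemma nn_integral_exp_density_pos:
  fixes f :: "real ^ 'n::finite \<Rightarrow> real"
  assumes [measurable]: "f \<in> borel_measurable borel" and nn: "\<And>x. 0 \<le> f x"
    and "(\<integral>\<^sup>+ x. ennreal (f x) \<partial>lborel) = 1"
  shows "0 < (\<integral>\<^sup>+ x. ennreal (exp (x \<bullet> \<xi>)) \<partial>density lborel (\<lambda>x. ennreal (f x)))"
proof (rule ccontr)
  assume "\<not> ?thesis"
  then have "(\<integral>\<^sup>+ x. ennreal (f x) * ennreal (exp (x \<bullet> \<xi>)) \<partial>lborel) = 0"
    by (simp add: nn_integral_density)
  then have "AE x in lborel. ennreal (f x) = 0"
    by (subst (asm) nn_integral_0_iff_AE) (auto simp: ennreal_eq_0_iff not_le)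
  then have "(\<integral>\<^sup>+ x. ennreal (f x) \<partial>lborel) = 0"
    by (subst nn_integral_0_iff_AE) auto
  then show False using assms by simp
qed

section \<open>Comparison with the Gaussian of equal second moment\<close>

theorem theorem4p17:
  fixes f :: "real ^ 'n::finite \<Rightarrow> real" and g :: "real \<Rightarrow> real"
  assumes f_meas: "f \<in> borel_measurable lborel"
    and f_nonneg: "\<And>x. 0 \<le> f x"
    and f_prob: "(\<integral>\<^sup>+ x. ennreal (f x) \<partial>lborel) = 1"
    and f_radial: "\<And>x. f x = g (norm x)"
    and f_logconc: "log_concave_fun f UNIV"
  shows "(log_convex_fun (\<lambda>r. g (sqrt r)) {0<..} \<longrightarrow>
           cramer_mean (density lborel (\<lambda>x. ennreal (f x)))
             \<ge> cramer_mean (density lborel (\<lambda>x. ennreal (std_gaussian_pdf (x :: real ^ 'n)))))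
       \<and> (log_concave_fun (\<lambda>r. g (sqrt r)) {0<..} \<longrightarrow>
           cramer_mean (density lborel (\<lambda>x. ennreal (f x)))
             \<le> cramer_mean (density lborel (\<lambda>x. ennreal (std_gaussian_pdf (x :: real ^ 'n)))))"
proof -
  have f [measurable]: "f \<in> borel_measurable borel"
    using f_meas by simp
  let ?P = "density lborel (\<lambda>x. ennreal (f x))"
  let ?M = "\<integral>\<^sup>+ x. ennreal ((norm x)\<^sup>2 * gaussian 1 x) \<partial>(lborel :: (real ^ 'n) measure)"
  let ?J = "\<integral>\<^sup>+ x. ennreal ((norm x)\<^sup>2 * f x) \<partial>lborel"
  have J: "0 < ?J" "?J < \<infinity>"
    using second_moment_pos[OF f f_nonneg f_prob]
      radial_log_concave_second_moment_finite[OF f f_nonneg f_prob f_radial f_logconc] by auto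
  have M: "0 < ?M" "?M < \<infinity>"
    using second_moment_pos[of "gaussian 1 :: real ^ 'n \<Rightarrow> real"] gaussian_second_moment_finite
    by (auto simp: gaussian_nonneg nn_integral_gaussian)
  \<comment> \<open>Chosen so that the Gaussian second moment \<open>s^2 * ?M\<close> equals
    \<open>?J\<close>.\<close>
  define s where "s = sqrt (enn2real ?J / enn2real ?M)"
  have jm: "0 < enn2real ?J" "0 < enn2real ?M"
    using J M by (auto simp: enn2real_positive_iff)
  have s: "0 < s"
    using jm by (simp add: s_def)
  have "ennreal (s\<^sup>2) * ?M = ennreal (s\<^sup>2) * ennreal (enn2real ?M)"
    using M by simp
  also have "\<dots> = ennreal (s\<^sup>2 * enn2real ?M)"
    by (simp add: ennreal_mult')
  also have "s\<^sup>2 * enn2real ?M = enn2real ?J"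
    using jm by (simp add: s_def)
  also have "ennreal (enn2real ?J) = ?J"
    using J by simp
  finally have moment: "(\<integral>\<^sup>+ x. ennreal ((norm x)\<^sup>2 * gaussian s x) \<partial>(lborel :: (real ^ 'n) measure)) = ?J"
    by (simp add: gaussian_second_moment[OF s])
  let ?\<gamma> = "gaussian s :: real ^ 'n \<Rightarrow> real"
  let ?Q = "density lborel (\<lambda>x. ennreal (?\<gamma> x))"
  \<comment> \<open>Both orders are recorded: \<open>f\<close> is the more spread out density in the
    log-convex case, \<open>?\<gamma>\<close> in the log-concave case.\<close>
  have fg: "same_mass_moment f ?\<gamma>" and gf: "same_mass_moment ?\<gamma> f"
    by (unfold_locales; use f_nonneg f_prob J moment s in \<open>simp add: nn_integral_gaussian gaussian_nonneg\<close>)+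
  define C where "C = (2 * pi * s\<^sup>2) powr (- real CARD('n) / 2)"
  define c where "c = 1 / (2 * s\<^sup>2)"
  have C: "0 < C" using s by (simp add: C_def)
  have \<gamma>: "?\<gamma> x = C * exp (- c * (norm x)\<^sup>2)" for x
    using s by (simp add: gaussian_eq C_def c_def)
  \<comment> \<open>The sign of \<open>g\<close> is known only through \<open>f\<close>, so a vector
    of norm \<open>sqrt u\<close> is needed.\<close>
  have h_nonneg: "0 \<le> g (sqrt u)" if "0 < u" for u
  proof -
    obtain x :: "real ^ 'n" where "norm x = sqrt u"
      using vector_choose_size[of "sqrt u"] \<open>0 < u\<close> by auto
    then show ?thesis
      using f_nonneg[of x] by (simp add: f_radial)
  qed
  have mgf: "(\<integral>\<^sup>+ x. ennreal (exp (x \<bullet> \<xi>)) \<partial>density lborel (\<lambda>x. ennreal (p x)))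
      = (\<integral>\<^sup>+ x. ennreal (exp (x \<bullet> \<xi>) * p x) \<partial>lborel)"
    if [measurable]: "p \<in> borel_measurable borel" for p :: "real ^ 'n \<Rightarrow> real" and \<xi>
    by (simp add: nn_integral_density ennreal_mult'' mult.commute)
  \<comment> \<open>Both sides equal \<open>2 powr (- n / 2)\<close> for dimension \<open>n\<close>,
    which allows passing from the standard Gaussian to the one with parameter
    \<open>s\<close>.\<close>
  have std: "cramer_mean (density lborel (\<lambda>x. ennreal (std_gaussian_pdf (x :: real ^ 'n))))
      = (\<integral>\<^sup>+ x. ennreal (exp (- (norm x)\<^sup>2 / (2 * s\<^sup>2)) * ?\<gamma> x) \<partial>lborel)"
    using cramer_mean_gaussian[of 1, where 'n='n] nn_integral_exp_neg_gaussian[OF s, where 'a="real ^ 'n"]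
    by (simp add: std_gaussian_pdf_eq)
  have P: "(\<integral>\<^sup>+ x. exp_neg_ereal (cramer ?Q x) \<partial>?P) = (\<integral>\<^sup>+ x. ennreal (exp (- (norm x)\<^sup>2 / (2 * s\<^sup>2)) * f x) \<partial>lborel)"
    by (rule nn_integral_exp_neg_cramer_gaussian[OF f s])
  show ?thesis
  proof (intro conjI impI)
    assume convex: "log_convex_fun (\<lambda>r. g (sqrt r)) {0<..}"
    interpret same_mass_moment f ?\<gamma> by (rule fg)
    let ?I = "{u. 0 < u \<and> g (sqrt u) < C * exp (- c * u)}"
    have I: "is_interval ?I" "?I \<subseteq> {0<..}"
      using is_interval_log_convex_less[OF convex h_nonneg C] by auto
    have less: "f x \<le> ?\<gamma> x" if "(norm x)\<^sup>2 \<in> ?I" for x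
      using that by (simp add: \<gamma> f_radial)
    have ge: "?\<gamma> x \<le> f x" if "x \<noteq> 0" "(norm x)\<^sup>2 \<notin> ?I" for x
      using that by (simp add: \<gamma> f_radial not_less)
    have exp_le: "(\<integral>\<^sup>+ x. ennreal (exp (- (norm x)\<^sup>2 / (2 * s\<^sup>2)) * ?\<gamma> x) \<partial>lborel)
        \<le> (\<integral>\<^sup>+ x. ennreal (exp (- (norm x)\<^sup>2 / (2 * s\<^sup>2)) * f x) \<partial>lborel)"
      by (rule exp_neg_square_le[OF _ I]) (use s in simp, erule less, erule (1) ge)
    \<comment> \<open>The moment generating function of \<open>?P\<close> is the larger one, and the
      Legendre transform reverses the order.\<close>
    have cramer_le: "cramer ?P x \<le> cramer ?Q x" for x
    proof (rule cramer_antimono, rule log_mgf_mono)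
      fix \<xi> :: "real ^ 'n"
      show "0 < (\<integral>\<^sup>+ x. ennreal (exp (x \<bullet> \<xi>)) \<partial>?Q)"
        by (rule nn_integral_exp_density_pos) (auto simp: gaussian_nonneg nn_integral_gaussian s)
      show "(\<integral>\<^sup>+ x. ennreal (exp (x \<bullet> \<xi>)) \<partial>?Q) \<le> (\<integral>\<^sup>+ x. ennreal (exp (x \<bullet> \<xi>)) \<partial>?P)"
        unfolding mgf[OF p_meas] mgf[OF q_meas]
        by (rule same_mass_moment_mgf_le[OF fg f_radial \<gamma> I]) (erule less, erule (1) ge)
    qed
    \<comment> \<open>The chain changes one ingredient at a time: \<open>exp_le\<close> replaces the
      law \<open>?Q\<close> by \<open>?P\<close> under the Gaussian transform, and this step
      replaces the transform.\<close>
    have "(\<integral>\<^sup>+ x. exp_neg_ereal (cramer ?Q x) \<partial>?P) \<le> cramer_mean ?P"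
      unfolding cramer_mean_def by (intro nn_integral_mono exp_neg_ereal_antimono cramer_le)
    then show "cramer_mean (density lborel (\<lambda>x. ennreal (std_gaussian_pdf (x :: real ^ 'n)))) \<le> cramer_mean ?P"
      unfolding P std by (rule order_trans[OF exp_le])
  next
    assume concave: "log_concave_fun (\<lambda>r. g (sqrt r)) {0<..}"
    \<comment> \<open>The roles are exchanged: the interval is now the set where \<open>f\<close>
      exceeds the Gaussian, and every inequality reverses.\<close>
    interpret same_mass_moment ?\<gamma> f by (rule gf)
    let ?I = "{u. 0 < u \<and> C * exp (- c * u) < g (sqrt u)}"
    have I: "is_interval ?I" "?I \<subseteq> {0<..}"
      using is_interval_log_concave_greater[OF concave C] by auto
    have less: "?\<gamma> x \<le> f x" if "(norm x)\<^sup>2 \<in> ?I" for x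
      using that by (simp add: \<gamma> f_radial)
    have ge: "f x \<le> ?\<gamma> x" if "x \<noteq> 0" "(norm x)\<^sup>2 \<notin> ?I" for x
      using that by (simp add: \<gamma> f_radial not_less)
    have exp_le: "(\<integral>\<^sup>+ x. ennreal (exp (- (norm x)\<^sup>2 / (2 * s\<^sup>2)) * f x) \<partial>lborel)
        \<le> (\<integral>\<^sup>+ x. ennreal (exp (- (norm x)\<^sup>2 / (2 * s\<^sup>2)) * ?\<gamma> x) \<partial>lborel)"
      by (rule exp_neg_square_le[OF _ I]) (use s in simp, erule less, erule (1) ge)
    have cramer_le: "cramer ?Q x \<le> cramer ?P x" for x
    proof (rule cramer_antimono, rule log_mgf_mono)
      fix \<xi> :: "real ^ 'n"
      show "0 < (\<integral>\<^sup>+ x. ennreal (exp (x \<bullet> \<xi>)) \<partial>?P)"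
        by (rule nn_integral_exp_density_pos) (auto simp: f_nonneg f_prob)
      show "(\<integral>\<^sup>+ x. ennreal (exp (x \<bullet> \<xi>)) \<partial>?P) \<le> (\<integral>\<^sup>+ x. ennreal (exp (x \<bullet> \<xi>)) \<partial>?Q)"
        unfolding mgf[OF p_meas] mgf[OF q_meas]
        by (rule same_mass_moment_mgf_le[OF gf \<gamma> f_radial I]) (erule less, erule (1) ge)
    qed
    have "cramer_mean ?P \<le> (\<integral>\<^sup>+ x. exp_neg_ereal (cramer ?Q x) \<partial>?P)"
      unfolding cramer_mean_def by (intro nn_integral_mono exp_neg_ereal_antimono cramer_le)
    then show "cramer_mean ?P \<le> cramer_mean (density lborel (\<lambda>x. ennreal (std_gaussian_pdf (x :: real ^ 'n))))"
      unfolding P std by (rule order_trans[OF _ exp_le])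
  qed
qed

end
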